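(* If $(\sigma,\pi)$ is a triangular weight pair, then $\mathsf{RSK}_{\sigma,\pi}$ is an upper-triangular matrix. Its set of eigenvalues is $\{1,-1\}$, with respective multiplicities $|\{\rho\in\mathsf{Comp}(\pi):\pi_1-\rho_1\text{ is even}\}|$ and $|\{\rho\in\mathsf{Comp}(\pi):\pi_1-\rho_1\text{ is odd}\}|$.
   Context: $\mathbb{N}=\{0,1,2,\dots\}$. RSK. A semistandard Young tableau is a filling of a Young diagram (English notation) by positive integers, weakly increasing along rows and strictly increasing down columns. Row insertion $P\leftarrow p$: if no label in the first row of $P$ exceeds $p$, append $p$ to the end of the first row; otherwise replace the leftmost occurrence of the smallest label $p'>p$ of the first row by $p$, and insert $p'$ in the same way into the tableau formed by the remaining rows. Inserting a biletter $(p|q)$ into a pair $(P,Q)$ of tableaux of the same shape yields $(P\leftarrow p,Q^\uparrow)$, where $Q^\uparrow$ is $Q$ with a new box labelled $q$ placed where $P\leftarrow p$ has a new box. For an $m\times n$ matrix $\alpha$ with entries in $\mathbb{N}$, list biletters by reading the entries of $\alpha$ down columns, columns from left to right, recording $\alpha_{i,j}$ copies of $(i|j)$. $\mathrm{RSK}(\alpha)=(P,Q)$ is the result of inserting these biletters successively into $(\emptyset,\emptyset)$. Operator. Let $R_{m,n}=\mathbb{C}[z_{ij}]_{1\le i\le m,1\le j\le n}$, $Z=[z_{ij}]$, and $z^\alpha=\prod_{i,j} z_{ij}^{\alpha_{i,j}}$. For semistandard $P,Q$ of the same shape, $[P|Q]\in R_{m,n}$ is the product over column positions $c$ of the minors of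 $Z$ whose row indices are the entries of the $c$-th column of $P$ and whose column indices are the entries of the $c$-th column of $Q$. Let $\mathsf{RSK}:R_{m,n}\to R_{m,n}$ be the linear map with $z^\alpha\mapsto[P|Q]$ where $(P,Q)=\mathrm{RSK}(\alpha)$. Weight spaces. A weight pair of degree $d$ is $(\sigma,\pi)\in\mathbb{N}^m\times\mathbb{N}^n$ with $\sum_i\sigma_i=\sum_j\pi_j=d$; $\ell(\sigma)=m$, $\ell(\pi)=n$ are the numbers of entries. By standing assumption all entries of $\sigma$ and $\pi$ are nonzero. $\mathsf{Cont}_{\sigma,\pi}$ is the set of $m\times n$ matrices over $\mathbb{N}$ with row sums $\sigma$ and column sums $\pi$. $\mathsf{RSK}$ preserves the span $R_{\sigma,\pi}$ of $\{z^\alpha:\alpha\in\mathsf{Cont}_{\sigma,\pi}\}$, and $\mathsf{RSK}_{\sigma,\pi}$ is the matrix whose $(\beta,\alpha)$ entry is the coefficient of $z^\beta$ in $\mathsf{RSK}(z^\alpha)$, with $\mathsf{Cont}_{\sigma,\pi}$ ordered so that $\alpha$ comes before $\alpha'$ if $z^\alpha>z^{\alpha'}$ in the lexicographic monomial order with $z_{11}>z_{21}>\dots>z_{m1}>z_{12}>\dots>z_{mn}$. The pair $(\sigma,\pi)$ is reduced if $\max_i\sigma_i+\max_j\pi_j\leq d$, and a reduced pair is triangular if $\ell(\sigma)=2$ and $\sigma_1=\pi_1$. For $\pi\in\mathbb{N}^n$, $\mathsf{Comp}(\pi)$ is the set of $\tau\in\mathbb{N}^n$ with $\tau_j\leq\pi_j$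 for $1\leq j\leq n$ and $\sum_{j=1}^n\tau_j=\pi_1$. *)

theory Defs
  imports
    "Jordan_Normal_Form.Char_Poly"
    "HOL-Library.Poly_Mapping"
    "HOL-Library.List_Lexorder"
begin

text \<open>
  Rows and columns of matrices, tableau labels and the entries of a weight are numbered from 0, as
  is usual for lists and for the matrices of Jordan_Normal_Form: the label i, the variable z(i,j)
  and the entry \<^term>\<open>\<sigma> ! i\<close> stand for what is written with i+1 and j+1 on paper. A tableau
  is the list of its rows, from top to bottom.
\<close>

type_synonym tableau = "nat list list"

subsection \<open>RSK\<close>

fun row_insert :: "tableau \<Rightarrow> nat \<Rightarrow> tableau" where
  "row_insert [] p = [[p]]"
| "row_insert (r # rs) p =
    (if \<forall>x\<in>set r. x \<le> p then (r @ [p]) # rs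
     else let p' = Min {x \<in> set r. p < x};
              k = (LEAST k. k < length r \<and> r ! k = p')
          in r[k := p] # row_insert rs p')"

definition row_length :: "tableau \<Rightarrow> nat \<Rightarrow> nat" where
  "row_length T i = (if i < length T then length (T ! i) else 0)"

definition new_box_row :: "tableau \<Rightarrow> tableau \<Rightarrow> nat" where
  "new_box_row T T' = (THE i. row_length T' i \<noteq> row_length T i)"

definition add_box :: "tableau \<Rightarrow> nat \<Rightarrow> nat \<Rightarrow> tableau" where
  "add_box T i q = (if i < length T then T[i := T ! i @ [q]] else T @ [[q]])"

definition insert_biletter :: "tableau \<times> tableau \<Rightarrow> nat \<times> nat \<Rightarrow> tableau \<times> tableau" where
  "insert_biletter = (\<lambda>(P, Q) (p, q).
     let P' = row_insert P p in (P', add_box Q (new_box_row P P') q))"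

definition biletters :: "nat mat \<Rightarrow> (nat \<times> nat) list" where
  "biletters \<alpha> =
     concat [replicate (\<alpha> $$ (i, j)) (i, j). j \<leftarrow> [0..<dim_col \<alpha>], i \<leftarrow> [0..<dim_row \<alpha>]]"

definition RSK :: "nat mat \<Rightarrow> tableau \<times> tableau" where
  "RSK \<alpha> = foldl insert_biletter ([], []) (biletters \<alpha>)"


subsection \<open>Polynomials in the entries of a generic matrix\<close>

text \<open>
  A monomial is its exponent function, a polynomial maps monomials to coefficients. The type has
  variables z(i,j) for all natural i and j; the ring of polynomials in the variables of a generic
  m by n matrix is the subset \<open>R_ring m n\<close>.
\<close>

type_synonym zmonom = "nat \<times> nat \<Rightarrow>\<^sub>0 nat"
type_synonym zpoly = "zmonom \<Rightarrow>\<^sub>0 complex"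

definition R_ring :: "nat \<Rightarrow> nat \<Rightarrow> zpoly set" where
  "R_ring m n = {f. \<forall>e \<in> Poly_Mapping.keys f. Poly_Mapping.keys e \<subseteq> {..<m} \<times> {..<n}}"

definition const :: "complex \<Rightarrow> zpoly" where
  "const c = Poly_Mapping.single 0 c"

definition zvar :: "nat \<Rightarrow> nat \<Rightarrow> zpoly" where
  "zvar i j = Poly_Mapping.single (Poly_Mapping.single (i, j) 1) 1"

definition exponent :: "nat mat \<Rightarrow> zmonom" where
  "exponent \<alpha> =
     (\<Sum>i<dim_row \<alpha>. \<Sum>j<dim_col \<alpha>. Poly_Mapping.single (i, j) (\<alpha> $$ (i, j)))"

definition exponent_mat :: "nat \<Rightarrow> nat \<Rightarrow> zmonom \<Rightarrow> nat mat" where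
  "exponent_mat m n e = mat m n (\<lambda>ij. Poly_Mapping.lookup e ij)"

definition zpow :: "nat mat \<Rightarrow> zpoly" where
  "zpow \<alpha> = (\<Prod>i<dim_row \<alpha>. \<Prod>j<dim_col \<alpha>. zvar i j ^ (\<alpha> $$ (i, j)))"

definition coeff_at :: "zpoly \<Rightarrow> nat mat \<Rightarrow> complex" where
  "coeff_at f \<beta> = Poly_Mapping.lookup f (exponent \<beta>)"

definition zminor :: "nat list \<Rightarrow> nat list \<Rightarrow> zpoly" where
  "zminor rs cs = det (mat (length rs) (length cs) (\<lambda>(a, b). zvar (rs ! a) (cs ! b)))"

definition tableau_col :: "tableau \<Rightarrow> nat \<Rightarrow> nat list" where
  "tableau_col T c = [r ! c. r \<leftarrow> T, c < length r]"

definition bitableau :: "tableau \<times> tableau \<Rightarrow> zpoly" where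
  "bitableau = (\<lambda>(P, Q).
     \<Prod>c<row_length P 0. zminor (tableau_col P c) (tableau_col Q c))"

text \<open>
  The linear operator; only its restriction to \<open>R_ring m n\<close> is meaningful.
\<close>

definition RSK_op :: "nat \<Rightarrow> nat \<Rightarrow> zpoly \<Rightarrow> zpoly" where
  "RSK_op m n f = (\<Sum>e \<in> Poly_Mapping.keys f.
     const (Poly_Mapping.lookup f e) * bitableau (RSK (exponent_mat m n e)))"


subsection \<open>Weight spaces\<close>

definition Cont :: "nat list \<Rightarrow> nat list \<Rightarrow> nat mat set" where
  "Cont \<sigma> \<pi> = {\<alpha> \<in> carrier_mat (length \<sigma>) (length \<pi>).
     (\<forall>i<length \<sigma>. (\<Sum>j<length \<pi>. \<alpha> $$ (i, j)) = \<sigma> ! i) \<and>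
     (\<forall>j<length \<pi>. (\<Sum>i<length \<sigma>. \<alpha> $$ (i, j)) = \<pi> ! j)}"

text \<open>
  The exponents of the variables in decreasing order of the variables, that is, down the columns
  from left to right. The lexicographic monomial order is the order of these words in
  \<^theory>\<open>HOL-Library.List_Lexorder\<close>.
\<close>

definition exponent_word :: "nat mat \<Rightarrow> nat list" where
  "exponent_word \<alpha> = [\<alpha> $$ (i, j). j \<leftarrow> [0..<dim_col \<alpha>], i \<leftarrow> [0..<dim_row \<alpha>]]"

definition Cont_list :: "nat list \<Rightarrow> nat list \<Rightarrow> nat mat list" where
  "Cont_list \<sigma> \<pi> = rev (sorted_key_list_of_set exponent_word (Cont \<sigma> \<pi>))"

definition RSK_mat :: "nat list \<Rightarrow> nat list \<Rightarrow> complex mat" where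
  "RSK_mat \<sigma> \<pi> = (let L = Cont_list \<sigma> \<pi> in
     mat (length L) (length L) (\<lambda>(b, a).
       coeff_at (RSK_op (length \<sigma>) (length \<pi>) (zpow (L ! a))) (L ! b)))"

definition weight_pair :: "nat list \<Rightarrow> nat list \<Rightarrow> nat \<Rightarrow> bool" where
  "weight_pair \<sigma> \<pi> d \<longleftrightarrow>
     sum_list \<sigma> = d \<and> sum_list \<pi> = d \<and> (\<forall>x\<in>set \<sigma>. x \<noteq> 0) \<and> (\<forall>x\<in>set \<pi>. x \<noteq> 0)"

definition reduced :: "nat list \<Rightarrow> nat list \<Rightarrow> nat \<Rightarrow> bool" where
  "reduced \<sigma> \<pi> d \<longleftrightarrow> weight_pair \<sigma> \<pi> d \<and> Max (set \<sigma>) + Max (set \<pi>) \<le> d"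

definition triangular :: "nat list \<Rightarrow> nat list \<Rightarrow> nat \<Rightarrow> bool" where
  "triangular \<sigma> \<pi> d \<longleftrightarrow> reduced \<sigma> \<pi> d \<and> length \<sigma> = 2 \<and> \<sigma> ! 0 = \<pi> ! 0"

definition Comp :: "nat list \<Rightarrow> nat list set" where
  "Comp \<pi> = {\<tau>. length \<tau> = length \<pi> \<and> (\<forall>j<length \<pi>. \<tau> ! j \<le> \<pi> ! j) \<and> sum_list \<tau> = \<pi> ! 0}"


subsection \<open>Consistency of the encodings\<close>

lemma lookup_exponent:
  "Poly_Mapping.lookup (exponent \<alpha>) (i, j) =
     (if i < dim_row \<alpha> \<and> j < dim_col \<alpha> then \<alpha> $$ (i, j) else 0)"
proof -
  have "Poly_Mapping.lookup (exponent \<alpha>) (i, j) =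
      (\<Sum>i'<dim_row \<alpha>. \<Sum>j'<dim_col \<alpha>. if i' = i \<and> j' = j then \<alpha> $$ (i', j') else 0)"
    by (simp add: exponent_def lookup_sum lookup_single when_def)
  also have "\<dots> = (\<Sum>i'<dim_row \<alpha>. if i' = i then
      (\<Sum>j'<dim_col \<alpha>. if j' = j then \<alpha> $$ (i', j') else 0) else 0)"
    by (intro sum.cong refl) simp
  finally show ?thesis by simp
qed

lemma exponent_mat_exponent:
  "\<alpha> \<in> carrier_mat m n \<Longrightarrow> exponent_mat m n (exponent \<alpha>) = \<alpha>"
  by (intro eq_matI) (auto simp: exponent_mat_def lookup_exponent)

lemma zvar_power: "zvar i j ^ k = Poly_Mapping.single (Poly_Mapping.single (i, j) k) 1"
  by (induction k) (simp_all add: zvar_def mult_single flip: single_one single_add)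

lemma prod_single:
  "(\<Prod>x\<in>A. Poly_Mapping.single (g x :: zmonom) (1 :: complex)) =
     Poly_Mapping.single (\<Sum>x\<in>A. g x) 1"
  by (induction A rule: infinite_finite_induct) (simp_all add: mult_single)

lemma zpow_eq_single: "zpow \<alpha> = Poly_Mapping.single (exponent \<alpha>) 1"
  by (simp add: zpow_def exponent_def zvar_power prod_single)

lemma zpow_in_R_ring: "\<alpha> \<in> carrier_mat m n \<Longrightarrow> zpow \<alpha> \<in> R_ring m n"
  by (auto simp: R_ring_def zpow_eq_single in_keys_iff lookup_exponent split: if_splits)

lemma RSK_op_zpow:
  "\<alpha> \<in> carrier_mat m n \<Longrightarrow> RSK_op m n (zpow \<alpha>) = bitableau (RSK \<alpha>)"
  by (simp add: RSK_op_def zpow_eq_single exponent_mat_exponent const_def)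

lemma RSK_op_superset:
  assumes "finite A" "Poly_Mapping.keys f \<subseteq> A"
  shows "RSK_op m n f = (\<Sum>e\<in>A.
     const (Poly_Mapping.lookup f e) * bitableau (RSK (exponent_mat m n e)))"
  unfolding RSK_op_def
  by (rule sum.mono_neutral_left) (use assms in \<open>auto simp: in_keys_iff const_def\<close>)

lemma RSK_op_add: "RSK_op m n (f + g) = RSK_op m n f + RSK_op m n g"
proof -
  let ?A = "Poly_Mapping.keys f \<union> Poly_Mapping.keys g"
  have *: "finite ?A" "Poly_Mapping.keys (f + g) \<subseteq> ?A"
    by (simp_all add: Poly_Mapping.keys_add)
  show ?thesis
    by (simp add: RSK_op_superset[OF *] RSK_op_superset[OF *(1), of f]
        RSK_op_superset[OF *(1), of g] lookup_add const_def single_add distrib_right sum.distrib)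
qed

lemma RSK_op_scale: "RSK_op m n (const c * f) = const c * RSK_op m n f"
proof -
  have lk: "Poly_Mapping.lookup (const c * f) e = c * Poly_Mapping.lookup f e" for e
    by (simp add: const_def map.rep_eq when_def flip: mult_map_scale_conv_mult)
  have *: "Poly_Mapping.keys (const c * f) \<subseteq> Poly_Mapping.keys f"
    by (auto simp: in_keys_iff lk)
  have "const (c * x) = const c * const x" for x
    by (simp add: const_def mult_single)
  then show ?thesis
    unfolding RSK_op_superset[OF finite_keys *] by (simp add: RSK_op_def lk sum_distrib_left mult.assoc)
qed

lemma finite_Cont: "finite (Cont \<sigma> \<pi>)"
proof -
  let ?m = "length \<sigma>" and ?n = "length \<pi>" and ?S = "{..sum_list \<sigma>}"
  let ?F = "({..<?m} \<times> {..<?n}) \<rightarrow>\<^sub>E ?S"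
  have "Cont \<sigma> \<pi> \<subseteq> (\<lambda>f. mat ?m ?n f) ` ?F"
  proof
    fix \<alpha> assume \<alpha>: "\<alpha> \<in> Cont \<sigma> \<pi>"
    have le: "\<alpha> $$ (i, j) \<le> sum_list \<sigma>" if "i < ?m" "j < ?n" for i j
    proof -
      have "\<alpha> $$ (i, j) \<le> (\<Sum>j<?n. \<alpha> $$ (i, j))"
        using that by (intro member_le_sum) auto
      also have "\<dots> = \<sigma> ! i" using \<alpha> that by (simp add: Cont_def)
      also have "\<dots> \<le> sum_list \<sigma>" using that by (simp add: member_le_sum_list)
      finally show ?thesis .
    qed
    have "\<alpha> = mat ?m ?n (restrict (\<lambda>ij. \<alpha> $$ ij) ({..<?m} \<times> {..<?n}))"
      using \<alpha> by (intro eq_matI) (auto simp: Cont_def)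
    moreover have "restrict (\<lambda>ij. \<alpha> $$ ij) ({..<?m} \<times> {..<?n}) \<in> ?F"
      using le by auto
    ultimately show "\<alpha> \<in> (\<lambda>f. mat ?m ?n f) ` ?F" by blast
  qed
  then show ?thesis
    by (rule finite_subset) (auto intro!: finite_PiE)
qed

lemma map_concat_eq:
  assumes "(concat [[f i j. i \<leftarrow> [0..<m]]. j \<leftarrow> [0..<n]]) =
    (concat [[g i j. i \<leftarrow> [0..<m]]. j \<leftarrow> [0..<n]])" "i < m" "j < n"
  shows "f i j = g i j"
proof -
  have "map (\<lambda>j. map (\<lambda>i. f i j) [0..<m]) [0..<n] = map (\<lambda>j. map (\<lambda>i. g i j) [0..<m]) [0..<n]"
    using assms(1) by (intro concat_injective) (auto simp: set_zip)
  then show ?thesis using assms(2,3) by auto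
qed

lemma inj_on_exponent_word: "inj_on exponent_word (Cont \<sigma> \<pi>)"
proof (rule inj_onI)
  fix \<alpha> \<beta> assume *: "\<alpha> \<in> Cont \<sigma> \<pi>" "\<beta> \<in> Cont \<sigma> \<pi>" "exponent_word \<alpha> = exponent_word \<beta>"
  show "\<alpha> = \<beta>"
  proof (rule eq_matI)
    fix i j assume "i < dim_row \<beta>" "j < dim_col \<beta>"
    then show "\<alpha> $$ (i, j) = \<beta> $$ (i, j)"
      using * map_concat_eq[of "\<lambda>i j. \<alpha> $$ (i, j)" "length \<sigma>" "length \<pi>" "\<lambda>i j. \<beta> $$ (i, j)" i j]
      by (auto simp: exponent_word_def Cont_def)
  qed (use * in \<open>auto simp: Cont_def\<close>)
qed

lemma Cont_list_spec:
  "set (Cont_list \<sigma> \<pi>) = Cont \<sigma> \<pi>"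
  "sorted_wrt (\<lambda>\<alpha> \<beta>. exponent_word \<alpha> > exponent_word \<beta>) (Cont_list \<sigma> \<pi>)"
proof -
  interpret folding_insort_key "(\<le>)" "(<)" "Cont \<sigma> \<pi>" exponent_word
    rewrites "linorder.sorted_key_list_of_set (\<le>) = sorted_key_list_of_set"
    by unfold_locales
      (auto simp: inj_on_exponent_word fun_eq_iff sorted_key_list_of_set_def
        linorder.sorted_key_list_of_set_def[OF linorder_class.linorder_axioms]
        insort_key_def linorder.insort_key_def[OF linorder_class.linorder_axioms])
  show "set (Cont_list \<sigma> \<pi>) = Cont \<sigma> \<pi>"
    using set_sorted_key_list_of_set[OF subset_refl finite_Cont] by (simp add: Cont_list_def)
  show "sorted_wrt (\<lambda>\<alpha> \<beta>. exponent_word \<alpha> > exponent_word \<beta>) (Cont_list \<sigma> \<pi>)"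
    using strict_sorted_key_list_of_set[OF subset_refl]
    by (simp add: Cont_list_def sorted_wrt_rev sorted_wrt_map)
qed

end

theory Submission
  imports Defs
begin

text \<open>
  Let \<open>a\<close> and \<open>b\<close> be the rows of \<open>\<alpha>\<close> and let \<open>p = \<sigma> ! 0 = \<pi> ! 0\<close>. The first column of \<open>\<alpha>\<close> puts \<open>b 0\<close> ones
  into the first row of the insertion tableau. As \<open>a 0 + b 0 = p = \<Sum>j. a j\<close>, this is exactly the number of
  zeros still to come, so each of them bumps a one: the second row of the recording tableau
  consists of \<open>a j\<close> copies of \<open>j\<close> for \<open>j \<ge> 1\<close>, and its first row begins with \<open>p\<close> zeros. Hence
  \<open>[P|Q]\<close> is the product of the minors \<open>z\<^sub>0\<^sub>0 z\<^sub>1\<^sub>j - z\<^sub>0\<^sub>j z\<^sub>1\<^sub>0\<close> to the powers \<open>a j\<close> (\<open>j \<ge> 1\<close>) and of a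
  monomial. Its unique term of least degree in \<open>z\<^sub>0\<^sub>0\<close> is \<open>(-1)^(p - a 0) z\<^sup>\<alpha>\<close>; the other
  monomials, of larger degree in \<open>z\<^sub>0\<^sub>0\<close>, come earlier in the order. So the matrix is upper
  triangular with these signs on the diagonal, and \<open>\<alpha>\<close> corresponds to its first row \<open>a\<close>, an element of
  \<open>Comp \<pi>\<close>.
\<close>

subsection \<open>Insertion of words in two letters\<close>

text \<open>Empty rows are dropped, as the tableaux of \<^const>\<open>row_insert\<close> have none.\<close>

definition two_rows :: "nat list \<Rightarrow> nat list \<Rightarrow> tableau" where
  "two_rows r s = filter (\<lambda>x. x \<noteq> []) [r, s]"

text \<open>The hypothesis excludes an empty first row above a nonempty second one; dropping the
  empty row would then move the second row up to index 0.\<close>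

lemma row_length_two_rows:
  assumes "r = [] \<longrightarrow> s = []"
  shows "row_length (two_rows r s) i = (if i = 0 then length r else if i = 1 then length s else 0)"
  using assms by (cases i) (auto simp: two_rows_def row_length_def nth_Cons split: nat.splits)

lemma new_box_row_two_rows:
  assumes "r = [] \<longrightarrow> s = []" "r' = [] \<longrightarrow> s' = []"
  shows "length r' \<noteq> length r \<Longrightarrow> length s' = length s \<Longrightarrow> new_box_row (two_rows r s) (two_rows r' s') = 0"
    and "length r' = length r \<Longrightarrow> length s' \<noteq> length s \<Longrightarrow> new_box_row (two_rows r s) (two_rows r' s') = 1"
  unfolding new_box_row_def using assms
  by (auto intro!: the_equality simp: row_length_two_rows split: if_splits)

lemma add_box_two_rows_0:
  assumes "r = [] \<longrightarrow> s = []"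
  shows "add_box (two_rows r s) 0 q = two_rows (r @ [q]) s"
  using assms by (auto simp: add_box_def two_rows_def)

lemma add_box_two_rows_1:
  assumes "r \<noteq> []"
  shows "add_box (two_rows r s) 1 q = two_rows r (s @ [q])"
  using assms by (auto simp: add_box_def two_rows_def)

text \<open>Columns increase strictly, so a semistandard tableau with labels 0 and 1 has at most two
  rows and only ones in the second. Three counts therefore describe the insertion tableau, while the
  rows \<open>U\<close> and \<open>V\<close> of the recording tableau are kept as lists.\<close>

definition rsk_state :: "nat \<Rightarrow> nat \<Rightarrow> nat \<Rightarrow> nat list \<Rightarrow> nat list \<Rightarrow> tableau \<times> tableau" where
  "rsk_state a x y U V = (two_rows (replicate a 0 @ replicate x 1) (replicate y 1), two_rows U V)"

lemma row_insert_one: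
  assumes "a + x = 0 \<longrightarrow> y = 0"
  shows "row_insert (two_rows (replicate a 0 @ replicate x 1) (replicate y 1)) 1 =
    two_rows (replicate a 0 @ replicate (Suc x) 1) (replicate y 1)"
  using assms by (auto simp: two_rows_def replicate_append_same)

lemma row_insert_zero_append:
  "row_insert (two_rows (replicate a 0) []) 0 = two_rows (replicate (Suc a) 0) []"
  by (auto simp: two_rows_def replicate_append_same)

text \<open>The leftmost one of the first row stands right after the \<open>a\<close> zeros. The
  inserted zero replaces it, and the expelled one finds nothing larger in a row of ones, so it is
  appended there.\<close>

lemma row_insert_zero_bump:
  "row_insert (two_rows (replicate a 0 @ replicate (Suc x) 1) (replicate y 1)) 0 =
    two_rows (replicate (Suc a) 0 @ replicate x 1) (replicate (Suc y) 1)"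
proof -
  let ?r = "replicate a (0::nat) @ replicate (Suc x) 1"
  have "{z \<in> set ?r. 0 < z} = {1}"
    by auto
  then have mn: "Min {z \<in> set ?r. 0 < z} = 1"
    by (metis Min_singleton)
  have nth: "?r ! k = (if k < a then 0 else 1)" if "k < length ?r" for k
    using that by (auto simp: nth_append nth_Cons split: nat.splits)
  have least: "(LEAST k. k < length ?r \<and> ?r ! k = 1) = a"
  proof (rule Least_equality)
    show "a < length ?r \<and> ?r ! a = 1" using nth[of a] by simp
    show "a \<le> k" if "k < length ?r \<and> ?r ! k = 1" for k
      using that nth[of k] by (metis not_le zero_neq_one)
  qed
  have upd: "?r[a := 0] = replicate (Suc a) 0 @ replicate x 1"
    by (induction a) auto
  have not_le: "\<not> (\<forall>z\<in>set ?r. z \<le> 0)"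
    by auto
  have ins: "row_insert (?r # rs) 0 = (replicate (Suc a) 0 @ replicate x 1) # row_insert rs 1" for rs
    unfolding row_insert.simps if_not_P[OF not_le] Let_def mn least upd ..
  have "two_rows ?r (replicate y 1) = ?r # filter (\<lambda>z. z \<noteq> []) [replicate y 1]"
    by (simp add: two_rows_def)
  moreover have "row_insert (filter (\<lambda>z. z \<noteq> []) [replicate y 1]) 1 = [replicate (Suc y) 1]"
    by (auto simp: replicate_append_same)
  ultimately show ?thesis
    by (simp only: ins) (simp add: two_rows_def)
qed

lemma insert_biletter_one:
  assumes "length U = a + x" "length V = y" "a + x = 0 \<longrightarrow> y = 0"
  shows "insert_biletter (rsk_state a x y U V) (1, q) = rsk_state a (Suc x) y (U @ [q]) V"
proof -
  let ?P = "two_rows (replicate a 0 @ replicate x 1) (replicate y 1)"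
  let ?P' = "two_rows (replicate a 0 @ replicate (Suc x) 1) (replicate y 1)"
  have "new_box_row ?P ?P' = 0"
    using assms(3) by (intro new_box_row_two_rows(1)) auto
  moreover have UV: "U = [] \<longrightarrow> V = []"
    using assms by auto
  ultimately show ?thesis
    using assms add_box_two_rows_0[OF UV]
    unfolding insert_biletter_def rsk_state_def Let_def prod.case row_insert_one[OF assms(3)] by simp
qed

lemma insert_biletter_zero_append:
  assumes "length U = a"
  shows "insert_biletter (rsk_state a 0 0 U []) (0, q) = rsk_state (Suc a) 0 0 (U @ [q]) []"
proof -
  have "new_box_row (two_rows (replicate a 0) []) (two_rows (replicate (Suc a) 0) []) = 0"
    by (intro new_box_row_two_rows(1)) auto
  then show ?thesis
    using assms add_box_two_rows_0[of U "[]" q]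
    by (simp add: insert_biletter_def rsk_state_def Let_def row_insert_zero_append[simplified])
qed

lemma insert_biletter_zero_bump:
  assumes "length U = a + Suc x" "length V = y"
  shows "insert_biletter (rsk_state a (Suc x) y U V) (0, q) = rsk_state (Suc a) x (Suc y) U (V @ [q])"
proof -
  let ?P = "two_rows (replicate a 0 @ replicate (Suc x) 1) (replicate y 1)"
  let ?P' = "two_rows (replicate (Suc a) 0 @ replicate x 1) (replicate (Suc y) 1)"
  have "new_box_row ?P ?P' = 1"
    by (intro new_box_row_two_rows(2)) auto
  moreover have "U \<noteq> []"
    using assms by auto
  ultimately show ?thesis
    using assms add_box_two_rows_1[of U V q]
    unfolding insert_biletter_def rsk_state_def Let_def prod.case row_insert_zero_bump by simp
qed

lemma insert_ones:
  assumes "length U = a + x" "length V = y" "a + x = 0 \<longrightarrow> y = 0"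
  shows "foldl insert_biletter (rsk_state a x y U V) (replicate k (1, q)) =
    rsk_state a (x + k) y (U @ replicate k q) V"
  using assms
proof (induction k arbitrary: x U)
  case (Suc k)
  then show ?case
    using insert_biletter_one[OF Suc.prems] Suc.IH[of "U @ [q]" "Suc x"] by simp
qed simp

text \<open>This serves the zeros of the first matrix column, which arrive before any one.\<close>

lemma insert_zeros_append:
  assumes "length U = a"
  shows "foldl insert_biletter (rsk_state a 0 0 U []) (replicate k (0, q)) =
    rsk_state (a + k) 0 0 (U @ replicate k q) []"
  using assms
proof (induction k arbitrary: a U)
  case (Suc k)
  then show ?case
    using insert_biletter_zero_append[OF Suc.prems] Suc.IH[of "U @ [q]" "Suc a"] by simp
qed simp

text \<open>Since \<open>k \<le> x\<close>, each of the zeros still finds a one to bump. All new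
  boxes therefore lie in the second row, and \<open>U\<close> does not change.\<close>

lemma insert_zeros_bump:
  assumes "length U = a + x" "length V = y" "k \<le> x"
  shows "foldl insert_biletter (rsk_state a x y U V) (replicate k (0, q)) =
    rsk_state (a + k) (x - k) (y + k) U (V @ replicate k q)"
  using assms
proof (induction k arbitrary: a x y V)
  case (Suc k)
  then obtain x' where x: "x = Suc x'" by (cases x) auto
  show ?case
    using insert_biletter_zero_bump[of U a x' V y] Suc.IH[of "Suc a" x' "V @ [q]" "Suc y"] Suc.prems x
    by simp
qed simp

section \<open>RSK of a matrix with two rows, column by column\<close>

definition biletters_upto :: "nat mat \<Rightarrow> nat \<Rightarrow> (nat \<times> nat) list" where
  "biletters_upto \<alpha> k =
     concat (map (\<lambda>j. replicate (\<alpha> $$ (0, j)) (0, j) @ replicate (\<alpha> $$ (1, j)) (1, j)) [0..<k])"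

lemma biletters_two_rows:
  assumes "dim_row \<alpha> = 2"
  shows "biletters \<alpha> = biletters_upto \<alpha> (dim_col \<alpha>)"
proof -
  have "[0..<2] = [0, 1::nat]" by (simp add: numeral_2_eq_2)
  moreover have "concat (concat (map (\<lambda>j. [f j, g j]) xs)) = concat (map (\<lambda>j. f j @ g j) xs)"
    for f g :: "nat \<Rightarrow> (nat \<times> nat) list" and xs
    by (induction xs) auto
  ultimately show ?thesis
    using assms by (simp add: biletters_def biletters_upto_def)
qed

text \<open>The index starts at 1 because the label 0 is treated apart: all biletters of the first
  matrix column are recorded in one initial block of zeros.\<close>

definition runs :: "(nat \<Rightarrow> nat) \<Rightarrow> nat \<Rightarrow> nat list" where
  "runs f k = concat (map (\<lambda>j. replicate (f j) j) [1..<k])"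

lemma runs_Suc: "0 < k \<Longrightarrow> runs f (Suc k) = runs f k @ replicate (f k) k"
  by (simp add: runs_def)

lemma runs_1 [simp]: "runs f (Suc 0) = []"
  by (simp add: runs_def)

lemma length_runs: "length (runs f k) = sum f {1..<k}"
  by (induction k) (auto simp: runs_def)

lemma count_list_replicate: "count_list (replicate k x) y = (if x = y then k else 0)"
  by (induction k) auto

lemma count_list_runs: "count_list (runs f k) j = (if 1 \<le> j \<and> j < k then f j else 0)"
proof (induction k)
  case (Suc k)
  then show ?case
    by (cases "k = 0") (auto simp: runs_Suc count_list_replicate)
qed (simp add: runs_def)

text \<open>The first column leaves \<open>b 0\<close> ones in the first row, and by the last
  hypothesis exactly \<open>b 0\<close> zeros follow in the later columns. So those zeros always
  bump and are recorded in the second row, whereas ones are always appended to the first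
  row.\<close>

lemma RSK_prefix:
  fixes \<alpha> :: "nat mat" and k :: nat
  defines "a \<equiv> \<lambda>j. \<alpha> $$ (0, j)" and "b \<equiv> \<lambda>j. \<alpha> $$ (1, j)"
  assumes "0 < k" "k \<le> n" "0 < a 0 + b 0" "sum a {1..<n} = b 0"
  shows "foldl insert_biletter ([], []) (biletters_upto \<alpha> k) =
    rsk_state (sum a {..<k}) (b 0 - sum a {1..<k} + sum b {1..<k}) (sum a {1..<k})
      (replicate (a 0 + b 0) 0 @ runs b k) (runs a k)"
  using assms(3,4)
proof (induction k rule: nat_induct_non_zero)
  case 1
  have 0: "([], []) = rsk_state 0 0 0 [] []"
    by (simp add: rsk_state_def two_rows_def)
  show ?case
    by (simp add: biletters_upto_def 0 insert_zeros_append insert_ones[unfolded One_nat_def] a_def b_def flip: replicate_add)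
next
  case (Suc k)
  \<comment> \<open>The ones left by the first column suffice for the zeros of column
    \<open>k\<close> too. This gives the side condition of \<open>insert_zeros_bump\<close> and
    keeps the natural subtraction in \<open>?x\<close> from truncating.\<close>
  have le: "sum a {1..<k} + a k \<le> b 0"
  proof -
    have "sum a {1..<Suc k} \<le> sum a {1..<n}"
      using Suc.prems by (intro sum_mono2) auto
    then show ?thesis using Suc.hyps assms(6) by simp
  qed
  have split: "sum a {..<k} = a 0 + sum a {1..<k}"
    using Suc.hyps by (simp add: lessThan_atLeast0 sum.atLeast_Suc_lessThan)
  let ?x = "b 0 - sum a {1..<k} + sum b {1..<k}"
  have "foldl insert_biletter ([], []) (biletters_upto \<alpha> (Suc k)) =
    foldl insert_biletter (foldl insert_biletter (rsk_state (sum a {..<k}) ?x (sum a {1..<k})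
      (replicate (a 0 + b 0) 0 @ runs b k) (runs a k)) (replicate (a k) (0, k))) (replicate (b k) (1, k))"
    using Suc by (simp add: biletters_upto_def a_def b_def)
  also have "\<dots> = foldl insert_biletter (rsk_state (sum a {..<k} + a k) (?x - a k) (sum a {1..<k} + a k)
      (replicate (a 0 + b 0) 0 @ runs b k) (runs a k @ replicate (a k) k)) (replicate (b k) (1, k))"
    using le split by (subst insert_zeros_bump) (auto simp: length_runs)
  also have "\<dots> = rsk_state (sum a {..<k} + a k) (?x - a k + b k) (sum a {1..<k} + a k)
      ((replicate (a 0 + b 0) 0 @ runs b k) @ replicate (b k) k) (runs a k @ replicate (a k) k)"
    using le split assms(5) by (subst insert_ones) (auto simp: length_runs)
  also have "?x - a k + b k = b 0 - sum a {1..<Suc k} + sum b {1..<Suc k}"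
    using le Suc.hyps by simp
  finally show ?case
    using Suc.hyps by (simp add: runs_Suc)
qed

subsection \<open>The lowest term of a bitableau\<close>

lemma zminor_single: "zminor [i] [j] = zvar i j"
  by (simp add: zminor_def det_single)

lemma zminor_pair:
  "zminor [i, i'] [j, j'] = zvar i j * zvar i' j' - zvar i j' * zvar i' j"
proof -
  let ?A = "mat 2 2 (\<lambda>(a, b). zvar ([i, i'] ! a) ([j, j'] ! b))"
  have "det ?A = (\<Sum>k<2. ?A $$ (k, 0) * cofactor ?A k 0)"
    by (intro laplace_expansion_column) auto
  also have "\<dots> = ?A $$ (0, 0) * cofactor ?A 0 0 + ?A $$ (1, 0) * cofactor ?A 1 0"
    by (simp add: numeral_2_eq_2)
  also have "\<dots> = zvar i j * zvar i' j' - zvar i j' * zvar i' j"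
    by (simp add: cofactor_def mat_delete_def det_single mult.commute)
  finally show ?thesis
    by (simp add: zminor_def numeral_2_eq_2)
qed

text \<open>The part of least degree in z(0,0) is required to be a single term. As z(0,0) is the
  largest variable, two monomials of different degree in it are already ordered lexicographically by
  that degree.\<close>

definition lowest :: "zpoly \<Rightarrow> zmonom \<Rightarrow> complex \<Rightarrow> bool" where
  "lowest f e c \<longleftrightarrow> (\<exists>g. f = Poly_Mapping.single e c + g \<and>
     (\<forall>k\<in>Poly_Mapping.keys g. Poly_Mapping.lookup e (0, 0) < Poly_Mapping.lookup k (0, 0)))"

lemma lowest_single: "lowest (Poly_Mapping.single e c) e c"
  by (auto simp: lowest_def intro!: exI[of _ 0])

lemma lowest_one: "lowest 1 0 1"
  using lowest_single[of 0 1] by simp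

lemma lowest_zvar: "lowest (zvar i j) (Poly_Mapping.single (i, j) 1) 1"
  unfolding zvar_def by (rule lowest_single)

text \<open>Degrees in z(0,0) add, so every cross term, having a factor from one of the remainders,
  lies strictly above the product of the two lowest terms.\<close>

lemma lowest_mult:
  assumes "lowest f e c" "lowest f' e' c'"
  shows "lowest (f * f') (e + e') (c * c')"
proof -
  obtain g where g: "f = Poly_Mapping.single e c + g"
    "\<And>k. k \<in> Poly_Mapping.keys g \<Longrightarrow> Poly_Mapping.lookup e (0, 0) < Poly_Mapping.lookup k (0, 0)"
    using assms(1) by (auto simp: lowest_def)
  obtain g' where g': "f' = Poly_Mapping.single e' c' + g'"
    "\<And>k. k \<in> Poly_Mapping.keys g' \<Longrightarrow> Poly_Mapping.lookup e' (0, 0) < Poly_Mapping.lookup k (0, 0)"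
    using assms(2) by (auto simp: lowest_def)
  let ?h = "Poly_Mapping.single e c * g' + g * Poly_Mapping.single e' c' + g * g'"
  have "f * f' = Poly_Mapping.single (e + e') (c * c') + ?h"
    by (simp add: g(1) g'(1) algebra_simps mult_single)
  moreover have "Poly_Mapping.lookup (e + e') (0, 0) < Poly_Mapping.lookup k (0, 0)"
    if k: "k \<in> Poly_Mapping.keys ?h" for k
  proof -
    consider "k \<in> Poly_Mapping.keys (Poly_Mapping.single e c * g')"
      | "k \<in> Poly_Mapping.keys (g * Poly_Mapping.single e' c')" | "k \<in> Poly_Mapping.keys (g * g')"
      using k Poly_Mapping.keys_add[of "Poly_Mapping.single e c * g' + g * Poly_Mapping.single e' c'" "g * g'"]
        Poly_Mapping.keys_add[of "Poly_Mapping.single e c * g'" "g * Poly_Mapping.single e' c'"]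
      by blast
    then show ?thesis
    proof cases
      case 1
      then obtain u v where "k = u + v" "u \<in> Poly_Mapping.keys (Poly_Mapping.single e c)" "v \<in> Poly_Mapping.keys g'"
        using keys_mult by blast
      then show ?thesis using g'(2)[of v] by (auto simp: lookup_add split: if_splits)
    next
      case 2
      then obtain u v where "k = u + v" "u \<in> Poly_Mapping.keys g" "v \<in> Poly_Mapping.keys (Poly_Mapping.single e' c')"
        using keys_mult by blast
      then show ?thesis using g(2)[of u] by (auto simp: lookup_add split: if_splits)
    next
      case 3
      then obtain u v where "k = u + v" "u \<in> Poly_Mapping.keys g" "v \<in> Poly_Mapping.keys g'"
        using keys_mult by blast
      then show ?thesis using g(2)[of u] g'(2)[of v] by (simp add: lookup_add)
    qed
  qed
  ultimately show ?thesis
    unfolding lowest_def by blast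
qed

lemma lowest_prod_list:
  assumes "\<And>x. x \<in> set xs \<Longrightarrow> lowest (f x) (e x) (c x)"
  shows "lowest (\<Prod>x\<leftarrow>xs. f x) (\<Sum>x\<leftarrow>xs. e x) (\<Prod>x\<leftarrow>xs. c x)"
  using assms by (induction xs) (auto intro: lowest_one lowest_mult)

text \<open>The first claim will give the diagonal entries of the matrix, the second the vanishing
  of the entries below the diagonal.\<close>

lemma lowest_lookup:
  assumes "lowest f e c"
  shows "Poly_Mapping.lookup f e = c"
    and "\<lbrakk>Poly_Mapping.lookup f k \<noteq> 0; k \<noteq> e\<rbrakk> \<Longrightarrow>
      Poly_Mapping.lookup e (0, 0) < Poly_Mapping.lookup k (0, 0)"
proof -
  obtain g where g: "f = Poly_Mapping.single e c + g"
    "\<And>k. k \<in> Poly_Mapping.keys g \<Longrightarrow> Poly_Mapping.lookup e (0, 0) < Poly_Mapping.lookup k (0, 0)"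
    using assms by (auto simp: lowest_def)
  have "e \<notin> Poly_Mapping.keys g"
    using g(2) by blast
  then show "Poly_Mapping.lookup f e = c"
    by (simp add: g(1) lookup_add in_keys_iff)
  show "Poly_Mapping.lookup e (0, 0) < Poly_Mapping.lookup k (0, 0)"
    if "Poly_Mapping.lookup f k \<noteq> 0" "k \<noteq> e"
    using that g(2)[of k] by (auto simp: g(1) lookup_add lookup_single in_keys_iff)
qed

text \<open>For \<open>0 < v\<close> only the positive term of the minor contains z(0,0), so the
  lowest term is the negative one. This is the source of all signs.\<close>

lemma lowest_minor:
  assumes "0 < v"
  shows "lowest (zvar 0 0 * zvar 1 v - zvar 0 v * zvar 1 0)
    (Poly_Mapping.single (0, v) 1 + Poly_Mapping.single (1, 0) 1) (- 1)"
proof -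
  have "zvar 0 0 * zvar 1 v - zvar 0 v * zvar 1 0 =
    Poly_Mapping.single (Poly_Mapping.single (0, v) 1 + Poly_Mapping.single (1, 0) 1) (- 1) +
    Poly_Mapping.single (Poly_Mapping.single (0, 0) 1 + Poly_Mapping.single (1, v) 1) 1"
    by (simp add: zvar_def mult_single single_uminus)
  then show ?thesis
    unfolding lowest_def using assms by (auto simp: lookup_add lookup_single)
qed

section \<open>Bitableaux of tableaux with at most two rows\<close>

lemma tableau_col_two_rows:
  "tableau_col (two_rows r s) c =
    (if c < length r then [r ! c] else []) @ (if c < length s then [s ! c] else [])"
  by (auto simp: tableau_col_def two_rows_def)

lemma prod_nth_eq_prod_list:
  "(\<Prod>i<length xs. f (xs ! i)) = prod_list (map f xs)" for f :: "nat \<Rightarrow> zpoly"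
  by (simp add: prod.list_conv_set_nth lessThan_atLeast0)

text \<open>The blocks of zeros in the two first rows have the same length \<open>p\<close>; in the
  application one length is a row sum and the other a column sum. Hence there are three kinds of
  columns: height two under the zeros, height one with both labels 0, and height one with label 1 in
  the insertion tableau.\<close>

lemma bitableau_rsk_state:
  assumes "length V \<le> p"
  shows "bitableau (rsk_state p (length W) (length V) (replicate p 0 @ W) V) =
    (\<Prod>v\<leftarrow>V. zvar 0 0 * zvar 1 v - zvar 0 v * zvar 1 0) * zvar 0 0 ^ (p - length V) * (\<Prod>w\<leftarrow>W. zvar 1 w)"
proof -
  let ?y = "length V" and ?x = "length W"
  let ?m = "\<lambda>v. zvar 0 0 * zvar 1 v - zvar 0 v * zvar 1 0"
  let ?P = "two_rows (replicate p 0 @ replicate ?x 1) (replicate ?y 1)"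
  let ?Q = "two_rows (replicate p 0 @ W) V"
  let ?F = "\<lambda>c. zminor (tableau_col ?P c) (tableau_col ?Q c)"
  have "row_length ?P 0 = p + ?x"
    using assms by (subst row_length_two_rows) auto
  then have "bitableau (rsk_state p ?x ?y (replicate p 0 @ W) V) = (\<Prod>c<p + ?x. ?F c)"
    by (simp add: bitableau_def rsk_state_def)
  also have "\<dots> = (\<Prod>c<?y. ?F c) * (\<Prod>c=?y..<p. ?F c) * (\<Prod>c=p..<p + ?x. ?F c)"
    using assms by (simp add: lessThan_atLeast0 prod.atLeastLessThan_concat)
  also have "(\<Prod>c<?y. ?F c) = (\<Prod>c<?y. ?m (V ! c))"
    using assms by (intro prod.cong refl) (simp add: tableau_col_two_rows nth_append zminor_pair)
  also have "\<dots> = (\<Prod>v\<leftarrow>V. ?m v)"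
    by (rule prod_nth_eq_prod_list)
  also have "(\<Prod>c=?y..<p. ?F c) = (\<Prod>c=?y..<p. zvar 0 0)"
    by (intro prod.cong refl) (simp add: tableau_col_two_rows nth_append zminor_single)
  also have "\<dots> = zvar 0 0 ^ (p - ?y)"
    by simp
  also have "(\<Prod>c=p..<p + ?x. ?F c) = (\<Prod>c=p..<p + ?x. zvar 1 (W ! (c - p)))"
    using assms by (intro prod.cong refl) (auto simp: tableau_col_two_rows nth_append zminor_single)
  also have "\<dots> = (\<Prod>c<?x. zvar 1 (W ! c))"
    using prod.shift_bounds_nat_ivl[of "\<lambda>c. zvar 1 (W ! (c - p))" 0 p ?x]
    by (simp add: add.commute lessThan_atLeast0)
  also have "\<dots> = (\<Prod>w\<leftarrow>W. zvar 1 w)"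
    by (rule prod_nth_eq_prod_list)
  finally show ?thesis .
qed

lemma lookup_sum_list_single:
  "Poly_Mapping.lookup (\<Sum>v\<leftarrow>V. Poly_Mapping.single (i, v) (1::nat)) (i', j) =
    (if i' = i then count_list V j else 0)"
  by (induction V) (auto simp: lookup_add lookup_single)

text \<open>Each column of height two contributes the sign -1, all other columns contribute
  1.\<close>

lemma lowest_bitableau_rsk_state:
  fixes V W :: "nat list"
  assumes "length V \<le> p" "0 \<notin> set V"
  defines "e \<equiv> (\<Sum>v\<leftarrow>V. Poly_Mapping.single (0, v) 1 + Poly_Mapping.single (1, 0) 1) +
    Poly_Mapping.single (0, 0) (p - length V) + (\<Sum>w\<leftarrow>W. Poly_Mapping.single (1, w) 1)"
  shows "lowest (bitableau (rsk_state p (length W) (length V) (replicate p 0 @ W) V)) e ((- 1) ^ length V)"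
proof -
  have "lowest (\<Prod>v\<leftarrow>V. zvar 0 0 * zvar 1 v - zvar 0 v * zvar 1 0)
    (\<Sum>v\<leftarrow>V. Poly_Mapping.single (0, v) 1 + Poly_Mapping.single (1, 0) 1) (\<Prod>v\<leftarrow>V. - 1)"
    using assms(2) by (intro lowest_prod_list lowest_minor) (metis gr0I)
  moreover have "lowest (zvar 0 0 ^ (p - length V)) (Poly_Mapping.single (0, 0) (p - length V)) 1"
    unfolding zvar_power by (rule lowest_single)
  moreover have "lowest (\<Prod>w\<leftarrow>W. zvar 1 w) (\<Sum>w\<leftarrow>W. Poly_Mapping.single (1, w) 1) (\<Prod>w\<leftarrow>W. 1)"
    by (intro lowest_prod_list lowest_zvar)
  ultimately have "lowest (bitableau (rsk_state p (length W) (length V) (replicate p 0 @ W) V)) e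
      ((\<Prod>v\<leftarrow>V. - 1) * 1 * (\<Prod>w\<leftarrow>W. 1))"
    unfolding bitableau_rsk_state[OF assms(1)] e_def by (intro lowest_mult)
  then show ?thesis
    by (simp add: map_replicate_const prod_list_replicate)
qed

lemma lowest_RSK:
  assumes \<alpha>: "\<alpha> \<in> carrier_mat 2 n"
    and col: "\<alpha> $$ (0, 0) + \<alpha> $$ (1, 0) = p" and "0 < p" "0 < n"
    and row: "(\<Sum>j<n. \<alpha> $$ (0, j)) = p"
  shows "lowest (bitableau (RSK \<alpha>)) (exponent \<alpha>) ((- 1) ^ (p - \<alpha> $$ (0, 0)))"
proof -
  define a where "a = (\<lambda>j. \<alpha> $$ (0, j))"
  define b where "b = (\<lambda>j. \<alpha> $$ (1, j))"
  have "sum a {..<n} = a 0 + sum a {1..<n}"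
    using \<open>0 < n\<close> by (simp add: lessThan_atLeast0 sum.atLeast_Suc_lessThan)
  \<comment> \<open>The first row and the first column share the entry \<open>a 0\<close> and the
    sum \<open>p\<close>, so what remains of the row equals what remains of the column.\<close>
  then have sa: "sum a {1..<n} = b 0" "sum a {..<n} = p"
    using row col by (simp_all add: a_def b_def)
  let ?V = "runs a n" and ?W = "runs b n"
  have "RSK \<alpha> = foldl insert_biletter ([], []) (biletters_upto \<alpha> n)"
    using \<alpha> by (simp add: RSK_def biletters_two_rows)
  also have "\<dots> = rsk_state (sum a {..<n}) (b 0 - sum a {1..<n} + sum b {1..<n}) (sum a {1..<n})
      (replicate (a 0 + b 0) 0 @ runs b n) (runs a n)"
    unfolding a_def b_def using assms sa by (intro RSK_prefix) (auto simp: a_def b_def)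
  \<comment> \<open>After the last column the zeros have used up exactly the \<open>b 0\<close> ones
    of the first column, so the difference vanishes and the ones left in the first row are counted
    by \<open>?W\<close>.\<close>
  also have "\<dots> = rsk_state p (length ?W) (length ?V) (replicate p 0 @ ?W) ?V"
    using sa col by (simp add: length_runs a_def b_def)
  finally have RSK: "RSK \<alpha> = \<dots>" .
  have len: "length ?V = b 0"
    using sa by (simp add: length_runs)
  let ?e = "(\<Sum>v\<leftarrow>?V. Poly_Mapping.single (0, v) 1 + Poly_Mapping.single (1, 0) 1) +
    Poly_Mapping.single (0, 0) (p - length ?V) + (\<Sum>w\<leftarrow>?W. Poly_Mapping.single (1, w) 1)"
  have "lowest (bitableau (RSK \<alpha>)) ?e ((- 1) ^ length ?V)"
    unfolding RSK using len col by (intro lowest_bitableau_rsk_state) (auto simp: runs_def b_def)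
  moreover have "length ?V = p - \<alpha> $$ (0, 0)"
    using col len by (simp add: b_def)
  \<comment> \<open>The labels in \<open>?V\<close> restore the first row beyond column 0, and the
    \<open>b 0\<close> minors supply one z(1,0) each. The \<open>p - b 0 = a 0\<close> columns with
    both labels 0 restore z(0,0), and \<open>?W\<close> restores the rest of the second row.\<close>
  moreover have "?e = exponent \<alpha>"
  proof (rule poly_mapping_eqI)
    fix ij :: "nat \<times> nat"
    obtain i j where ij: "ij = (i, j)" by fastforce
    have s: "Poly_Mapping.lookup (\<Sum>v\<leftarrow>V. Poly_Mapping.single (0, v) 1 + Poly_Mapping.single (1, 0) 1) (i, j) =
      (if i = 0 then count_list V j else 0) + (if i = 1 \<and> j = 0 then length V else 0)" for V :: "nat list"
      by (induction V) (auto simp: lookup_add lookup_single)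
    have "Poly_Mapping.lookup ?e ij = (if i = 0 then count_list ?V j else 0) +
      (if i = 1 \<and> j = 0 then b 0 else 0) + (if i = 0 \<and> j = 0 then p - b 0 else 0) +
      (if i = 1 then count_list ?W j else 0)"
      unfolding ij s lookup_add lookup_sum_list_single lookup_single len when_def by auto
    also have "\<dots> = (if i = 0 \<and> j < n then a j else if i = 1 \<and> j < n then b j else 0)"
    proof -
      have "p - b 0 = a 0" using col by (simp add: a_def b_def)
      then show ?thesis using \<open>0 < n\<close> by (auto simp: count_list_runs Suc_le_eq)
    qed
    also have "\<dots> = Poly_Mapping.lookup (exponent \<alpha>) ij"
      using \<alpha> by (auto simp: ij lookup_exponent a_def b_def less_2_cases_iff)
    finally show "Poly_Mapping.lookup ?e ij = Poly_Mapping.lookup (exponent \<alpha>) ij" .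
  qed
  ultimately show ?thesis by simp
qed

subsection \<open>The matrix of the operator\<close>

text \<open>The characteristic polynomial of a triangular matrix is such a product over its
  diagonal, so algebraic multiplicities become counts of diagonal entries.\<close>

lemma order_prod_list_linear:
  "Polynomial.order k (\<Prod>a\<leftarrow>xs. [:- a, 1:]) = count_list xs k" for k :: "'a :: field"
proof (induction xs)
  case (Cons a xs)
  have "(\<Prod>a\<leftarrow>xs. [:- a, 1:]) \<noteq> 0"
    by (auto simp: prod_list_zero_iff)
  then have "[:- a, 1:] * (\<Prod>a\<leftarrow>xs. [:- a, 1:]) \<noteq> 0"
    \<comment> \<open>The rule is removed so that the product stays factored and is not expanded
      into coefficients.\<close>
    by (simp del: mult_pCons_left)
  moreover have "Polynomial.order k [:- a, 1:] = (if a = k then 1 else 0)"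
    using order_power_n_n[of a 1] by (auto intro: order_0I)
  ultimately show ?case
    using Cons by (simp add: order_mult del: mult_pCons_left)
qed simp

lemma count_list_map_distinct:
  "distinct xs \<Longrightarrow> count_list (map f xs) y = card {x \<in> set xs. f x = y}"
proof (induction xs)
  case (Cons x xs)
  have "{z \<in> set (x # xs). f z = y} = (if f x = y then insert x else id) {z \<in> set xs. f z = y}"
    by auto
  then show ?case
    using Cons by simp
qed simp

lemma eigenvalues_upper_triangular:
  fixes A :: "'a :: field mat"
  assumes "A \<in> carrier_mat n n" "upper_triangular A"
  shows "{k. eigenvalue A k} = set (diag_mat A)"
proof -
  have "eigenvalue A k \<longleftrightarrow> k \<in> set (diag_mat A)" for k
  proof -
    have "poly (\<Prod>a\<leftarrow>xs. [:- a, 1:]) k = 0 \<longleftrightarrow> k \<in> set xs" for xs :: "'a list"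
      by (induction xs) auto
    then show ?thesis
      by (simp add: eigenvalue_root_char_poly[OF assms(1)] char_poly_upper_triangular[OF assms])
  qed
  then show ?thesis by blast
qed

lemma exponent_eq_iff:
  assumes "\<alpha> \<in> carrier_mat m n" "\<beta> \<in> carrier_mat m n"
  shows "exponent \<alpha> = exponent \<beta> \<longleftrightarrow> \<alpha> = \<beta>"
  using assms by (metis exponent_mat_exponent)

text \<open>The entry at (0,0) is the first letter of the word, so it decides the
  comparison.\<close>

lemma exponent_word_less:
  assumes "\<alpha> \<in> carrier_mat m n" "\<beta> \<in> carrier_mat m n" "0 < m" "0 < n"
    and "\<alpha> $$ (0, 0) < \<beta> $$ (0, 0)"
  shows "exponent_word \<alpha> < exponent_word \<beta>"
  using assms by (simp add: exponent_word_def upt_conv_Cons)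

section \<open>Triangular weight pairs and compositions\<close>

lemma triangularD:
  assumes "triangular \<sigma> \<pi> d"
  shows "length \<sigma> = 2" "\<sigma> ! 0 = \<pi> ! 0" "1 < length \<pi>" "0 < \<pi> ! 0" "0 < \<pi> ! 1"
    "\<sigma> ! 0 + \<sigma> ! 1 = sum_list \<pi>"
proof -
  show len: "length \<sigma> = 2" and eq: "\<sigma> ! 0 = \<pi> ! 0"
    using assms by (auto simp: triangular_def)
  then obtain s t where \<sigma>: "\<sigma> = [s, t]"
    by (cases \<sigma>; cases "tl \<sigma>") auto
  have *: "s + t = sum_list \<pi>" "0 < s" "0 < t" "\<forall>x\<in>set \<pi>. 0 < x"
    using assms by (auto simp: triangular_def reduced_def weight_pair_def \<sigma>)
  show "\<sigma> ! 0 + \<sigma> ! 1 = sum_list \<pi>" "0 < \<pi> ! 0"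
    using * eq by (auto simp: \<sigma>)
  \<comment> \<open>If \<open>\<pi>\<close> were empty, its sum could not be positive; if it were
    \<open>[x]\<close>, then \<open>s = x = s + t\<close> would force \<open>t = 0\<close>.\<close>
  show "1 < length \<pi>"
  proof (rule ccontr)
    assume "\<not> ?thesis"
    then consider "\<pi> = []" | "\<exists>x. \<pi> = [x]"
      by (cases \<pi>; cases "tl \<pi>") auto
    then show False
      using * eq by cases (auto simp: \<sigma>)
  qed
  then show "0 < \<pi> ! 1"
    using * by simp
qed

text \<open>The column sums determine the second row from the first. The sum of the second row is
  then automatically right, since both weights have the same total.\<close>

lemma Cont_row_Comp_bij:
  assumes "triangular \<sigma> \<pi> d"
  shows "bij_betw (\<lambda>\<alpha>. map (\<lambda>j. \<alpha> $$ (0, j)) [0..<length \<pi>]) (Cont \<sigma> \<pi>) (Comp \<pi>)"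
proof -
  let ?n = "length \<pi>"
  note t = triangularD[OF assms]
  let ?g = "\<lambda>\<rho>. mat 2 ?n (\<lambda>(i, j). if i = 0 then \<rho> ! j else \<pi> ! j - \<rho> ! j)"
  have two: "(\<Sum>i<2. f i) = f 0 + f 1" "(\<forall>i<2::nat. P i) \<longleftrightarrow> P 0 \<and> P 1"
    for f :: "nat \<Rightarrow> nat" and P
    by (auto simp: numeral_2_eq_2 less_Suc_eq)
  show ?thesis
  proof (rule bij_betw_byWitness[where f' = ?g])
    show "\<forall>\<alpha>\<in>Cont \<sigma> \<pi>. ?g (map (\<lambda>j. \<alpha> $$ (0, j)) [0..<?n]) = \<alpha>"
    proof
      fix \<alpha> assume \<alpha>: "\<alpha> \<in> Cont \<sigma> \<pi>"
      then have col: "\<alpha> $$ (0, j) + \<alpha> $$ (1, j) = \<pi> ! j" if "j < ?n" for j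
        using that t(1) by (simp add: Cont_def two)
      show "?g (map (\<lambda>j. \<alpha> $$ (0, j)) [0..<?n]) = \<alpha>"
      proof (rule eq_matI)
        fix i j assume "i < dim_row \<alpha>" "j < dim_col \<alpha>"
        then have "i = 0 \<or> i = 1" "j < ?n" "i < 2"
          using \<alpha> t(1) by (auto simp: Cont_def)
        then show "?g (map (\<lambda>j. \<alpha> $$ (0, j)) [0..<?n]) $$ (i, j) = \<alpha> $$ (i, j)"
          using col[of j] by auto
      qed (use \<alpha> t(1) in \<open>auto simp: Cont_def\<close>)
    qed
    show "\<forall>\<rho>\<in>Comp \<pi>. map (\<lambda>j. ?g \<rho> $$ (0, j)) [0..<?n] = \<rho>"
      by (auto simp: Comp_def intro!: nth_equalityI)
    show "(\<lambda>\<alpha>. map (\<lambda>j. \<alpha> $$ (0, j)) [0..<?n]) ` Cont \<sigma> \<pi> \<subseteq> Comp \<pi>"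
    proof clarify
      fix \<alpha> assume "\<alpha> \<in> Cont \<sigma> \<pi>"
      then have "(\<Sum>j<?n. \<alpha> $$ (0, j)) = \<pi> ! 0" "\<And>j. j < ?n \<Longrightarrow> \<alpha> $$ (0, j) + \<alpha> $$ (1, j) = \<pi> ! j"
        using t(1,2) by (simp_all add: Cont_def two)
      then show "map (\<lambda>j. \<alpha> $$ (0, j)) [0..<?n] \<in> Comp \<pi>"
        by (auto simp: Comp_def sum_list_sum_nth lessThan_atLeast0 simp flip: le_iff_add)
          (metis le_add1)
    qed
    show "?g ` Comp \<pi> \<subseteq> Cont \<sigma> \<pi>"
    proof clarify
      fix \<rho> assume "\<rho> \<in> Comp \<pi>"
      then have \<rho>: "length \<rho> = ?n" "\<And>j. j < ?n \<Longrightarrow> \<rho> ! j \<le> \<pi> ! j" "sum_list \<rho> = \<pi> ! 0"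
        by (auto simp: Comp_def)
      have r: "(\<Sum>j<?n. \<rho> ! j) = \<pi> ! 0"
        using \<rho> by (simp add: sum_list_sum_nth lessThan_atLeast0)
      have "(\<Sum>j<?n. \<pi> ! j - \<rho> ! j) = (\<Sum>j<?n. \<pi> ! j) - (\<Sum>j<?n. \<rho> ! j)"
        using \<rho>(2) by (intro sum_subtractf_nat) auto
      also have "\<dots> = sum_list \<pi> - \<pi> ! 0"
        unfolding r by (simp add: sum_list_sum_nth lessThan_atLeast0)
      also have "\<dots> = \<sigma> ! 1"
        using t by linarith
      finally show "?g \<rho> \<in> Cont \<sigma> \<pi>"
        using \<rho>(2) r t(1,2) by (simp add: Cont_def two)
    qed
  qed
qed

theorem proposition5p6:
  fixes \<sigma> \<pi> :: "nat list" and d :: nat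
  assumes "triangular \<sigma> \<pi> d"
  shows "upper_triangular (RSK_mat \<sigma> \<pi>)
    \<and> {k. eigenvalue (RSK_mat \<sigma> \<pi>) k} = {1, -1}
    \<and> Polynomial.order 1 (char_poly (RSK_mat \<sigma> \<pi>)) = card {\<rho> \<in> Comp \<pi>. even (\<pi> ! 0 - \<rho> ! 0)}
    \<and> Polynomial.order (-1) (char_poly (RSK_mat \<sigma> \<pi>)) = card {\<rho> \<in> Comp \<pi>. odd (\<pi> ! 0 - \<rho> ! 0)}"
proof -
  define L where "L = Cont_list \<sigma> \<pi>"
  define M where "M = RSK_mat \<sigma> \<pi>"
  let ?N = "length L" and ?n = "length \<pi>" and ?p = "\<pi> ! 0"
  note t = triangularD[OF assms]
  have M: "M \<in> carrier_mat ?N ?N"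
    by (simp add: M_def RSK_mat_def L_def Let_def)
  have set_L: "set L = Cont \<sigma> \<pi>"
    by (simp add: L_def Cont_list_spec)
  have sorted_L: "exponent_word (L ! j) < exponent_word (L ! i)" if "i < j" "j < ?N" for i j
    using that Cont_list_spec(2)[of \<sigma> \<pi>] by (simp add: L_def sorted_wrt_iff_nth_less)
  have distinct_L: "distinct L"
    unfolding distinct_conv_nth using sorted_L by (metis less_irrefl linorder_neqE_nat)
  have carrier: "\<alpha> \<in> carrier_mat 2 ?n" if "\<alpha> \<in> Cont \<sigma> \<pi>" for \<alpha>
    using that t(1) by (simp add: Cont_def)
  have entry: "M $$ (i, j) = Poly_Mapping.lookup (bitableau (RSK (L ! j))) (exponent (L ! i))"
    if "i < ?N" "j < ?N" for i j
  proof -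
    have "L ! j \<in> carrier_mat (length \<sigma>) ?n"
      using that carrier[of "L ! j"] set_L t(1) nth_mem by force
    then show ?thesis
      using that by (simp add: M_def RSK_mat_def Let_def coeff_at_def RSK_op_zpow flip: L_def)
  qed
  have low: "lowest (bitableau (RSK \<alpha>)) (exponent \<alpha>) ((- 1) ^ (?p - \<alpha> $$ (0, 0)))"
    if "\<alpha> \<in> Cont \<sigma> \<pi>" for \<alpha>
  proof (rule lowest_RSK[OF carrier[OF that]])
    have "?n > 0" using t(3) by linarith
    then show "\<alpha> $$ (0, 0) + \<alpha> $$ (1, 0) = ?p" "(\<Sum>j<?n. \<alpha> $$ (0, j)) = ?p" "0 < ?n"
      using that t(1,2) by (auto simp: Cont_def numeral_2_eq_2)
  qed (use t in auto)
  have diag: "M $$ (i, i) = (- 1) ^ (?p - L ! i $$ (0, 0))" if "i < ?N" for i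
  proof -
    have "L ! i \<in> Cont \<sigma> \<pi>"
      using that set_L nth_mem by blast
    then show ?thesis
      using that by (simp add: entry lowest_lookup(1)[OF low])
  qed
  have ut: "upper_triangular M"
  proof (rule upper_triangularI)
    fix i j assume ij: "j < i" "i < dim_row M"
    then have lt: "i < ?N" "j < ?N"
      using M by auto
    have Cont: "L ! i \<in> Cont \<sigma> \<pi>" "L ! j \<in> Cont \<sigma> \<pi>"
      using lt set_L nth_mem by blast+
    have less: "exponent_word (L ! i) < exponent_word (L ! j)"
      using ij lt sorted_L by blast
    show "M $$ (i, j) = 0"
    \<comment> \<open>A nonzero entry would make the monomial of \<open>L ! i\<close> a term of the
      image of \<open>L ! j\<close> other than the lowest one. Its larger degree in z(0,0) would
      place \<open>L ! i\<close> before \<open>L ! j\<close>, against \<open>j < i\<close>.\<close>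
    proof (rule ccontr)
      assume "M $$ (i, j) \<noteq> 0"
      moreover have "exponent (L ! i) \<noteq> exponent (L ! j)"
        using less by (auto simp: exponent_eq_iff[OF Cont[THEN carrier]])
      ultimately have "L ! j $$ (0, 0) < L ! i $$ (0, 0)"
        using lowest_lookup(2)[OF low[OF Cont(2)], of "exponent (L ! i)"] lt t
          Cont[THEN carrier] by (auto simp: entry lookup_exponent split: if_splits)
      then have "exponent_word (L ! j) < exponent_word (L ! i)"
        using t(3) by (intro exponent_word_less[OF carrier carrier]) (use Cont in auto)
      then show False
        using less by simp
    qed
  qed
  have diag_mat: "diag_mat M = map (\<lambda>\<alpha>. (- 1) ^ (?p - \<alpha> $$ (0, 0))) L"
    using M diag by (auto simp: diag_mat_def intro!: nth_equalityI)
  define row where "row = (\<lambda>\<alpha>::nat mat. map (\<lambda>j. \<alpha> $$ (0, j)) [0..<?n])"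
  have bij: "bij_betw row (Cont \<sigma> \<pi>) (Comp \<pi>)"
    unfolding row_def by (rule Cont_row_Comp_bij[OF assms])
  have row_0: "row \<alpha> ! 0 = \<alpha> $$ (0, 0)" for \<alpha>
  proof -
    have "\<pi> \<noteq> []" using t(3) by auto
    then show ?thesis by (simp add: row_def)
  qed
  \<comment> \<open>The diagonal is indexed by \<open>Cont \<sigma> \<pi>\<close>; as
    \<open>row\<close> keeps the entry at (0,0), the count carries over to
    \<open>Comp \<pi>\<close>.\<close>
  have order: "Polynomial.order k (char_poly M) = card {\<rho> \<in> Comp \<pi>. (- 1) ^ (?p - \<rho> ! 0) = k}" for k
  proof -
    have "Polynomial.order k (char_poly M) = card {\<alpha> \<in> Cont \<sigma> \<pi>. (- 1) ^ (?p - \<alpha> $$ (0, 0)) = k}"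
      unfolding char_poly_upper_triangular[OF M ut] order_prod_list_linear diag_mat
        count_list_map_distinct[OF distinct_L] set_L ..
    also have "\<dots> = card {\<rho> \<in> Comp \<pi>. (- 1) ^ (?p - \<rho> ! 0) = k}"
    proof (rule bij_betw_same_card)
      show "bij_betw row {\<alpha> \<in> Cont \<sigma> \<pi>. (- 1) ^ (?p - \<alpha> $$ (0, 0)) = k}
        {\<rho> \<in> Comp \<pi>. (- 1) ^ (?p - \<rho> ! 0) = k}"
        using bij by (rule bij_betw_Collect) (simp add: row_0)
    qed
    finally show ?thesis .
  qed
  have "{k. eigenvalue M k} = (\<lambda>\<rho>. (- 1) ^ (?p - \<rho> ! 0)) ` Comp \<pi>"
    unfolding eigenvalues_upper_triangular[OF M ut] bij_betw_imp_surj_on[OF bij, symmetric]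
    by (simp add: diag_mat set_L row_0 image_image)
  also have "\<dots> = {1, - 1}"
  proof -
    \<comment> \<open>These two compositions realise both signs: the exponents are 0 and 1. The
      second one exists because \<open>\<pi> ! 0\<close> and \<open>\<pi> ! 1\<close> are
      positive.\<close>
    have "[?p, 0] @ replicate (?n - 2) 0 \<in> Comp \<pi>" "[?p - 1, 1] @ replicate (?n - 2) 0 \<in> Comp \<pi>"
      using t(3-5) by (auto simp: Comp_def nth_Cons Suc_le_eq sum_list_replicate split: nat.splits)
    then have "(- 1) ^ (?p - ?p) \<in> (\<lambda>\<rho>. (- 1 :: complex) ^ (?p - \<rho> ! 0)) ` Comp \<pi>"
      "(- 1) ^ (?p - (?p - 1)) \<in> (\<lambda>\<rho>. (- 1 :: complex) ^ (?p - \<rho> ! 0)) ` Comp \<pi>"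
      by (metis append_Cons image_eqI nth_Cons_0)+
    moreover have "?p - (?p - 1) = 1"
      using t(4) by simp
    ultimately show ?thesis
      by (auto simp: minus_one_power_iff)
  qed
  finally have eig: "{k. eigenvalue M k} = {1, - 1}" .
  have pm: "(- 1 :: complex) ^ k = 1 \<longleftrightarrow> even k" "(- 1 :: complex) ^ k = - 1 \<longleftrightarrow> odd k" for k
    by (auto simp: minus_one_power_iff)
  show ?thesis
    using ut eig order[of 1] order[of "- 1"] unfolding M_def pm by blast
qed

end
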